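(* Suppose $0 < R \leq \infty$, $I = (0,R)$, and $f : I \to \mathbb{R}$. Fix an integer $n \geq 2$ and suppose that $f[A] \in \mathbb{P}_n$ for all $A \in \mathbb{P}_n^2(I)$ of the form $A = a {\bf 1}_{n \times n} + u u^T$, with $a \in [0,R)$ and $u \in [0,\sqrt{R-a})^n$. Then, if $n \ge 3$, $f \in C^{n-3}(I)$, $$f^{(k)}(x) \geq 0 \qquad \text{for all } x \in I,\ 0 \leq k \leq n-3,$$ and $f^{(n-3)}$ is a convex nondecreasing function on $I$. In particular (for all $n \geq 2$), if $f \in C^{n-1}(I)$, then $f^{(k)}(x) \geq 0$ for all $x \in I$ and $0 \leq k \leq n-1$.
   Context: $\mathbb{P}_n$ is the set of $n \times n$ real symmetric positive semidefinite matrices, and $\mathbb{P}_n^2(I)$ is the set of those with all entries in $I$ and rank at most $2$. ${\bf 1}_{n \times n}$ is the $n\times n$ matrix with all entries equal to $1$. For a matrix $A=(a_{ij})$ with entries in the domain of $f$, $f[A] := (f(a_{ij}))$ (entrywise application). The zeroth derivative of $f$ is $f$. If $R=\infty$ then $\sqrt{R-a}=\infty$. *)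

theory Defs
  imports "HOL-Analysis.Analysis" "HOL-Library.Extended_Real"
begin

definition psd_mats :: "(real ^ 'n ^ 'n) set"
  where "psd_mats = {A. transpose A = A \<and> (\<forall>x. 0 \<le> x \<bullet> (A *v x))}"

definition psd_mats_rank_le :: "nat \<Rightarrow> real set \<Rightarrow> (real ^ 'n ^ 'n) set"
  where "psd_mats_rank_le k I = {A \<in> psd_mats. (\<forall>i j. A $ i $ j \<in> I) \<and> rank A \<le> k}"

definition entrywise :: "(real \<Rightarrow> real) \<Rightarrow> real ^ 'n ^ 'm \<Rightarrow> real ^ 'n ^ 'm"
  where "entrywise f A = (\<chi> i j. f (A $ i $ j))"

definition all_ones :: "real ^ 'n ^ 'm"
  where "all_ones = (\<chi> i j. 1)"

definition outer_prod :: "real ^ 'm \<Rightarrow> real ^ 'n \<Rightarrow> real ^ 'n ^ 'm"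
  where "outer_prod u v = (\<chi> i j. u $ i * v $ j)"

text \<open>Only used for arguments in the interval from 0 to \<open>\<infinity>\<close>.\<close>

definition ereal_sqrt :: "ereal \<Rightarrow> ereal"
  where "ereal_sqrt x = (if x = \<infinity> then \<infinity> else ereal (sqrt (real_of_ereal x)))"

text \<open>Meant for open \<open>S\<close>: then \<open>(deriv ^^ j) f\<close> on \<open>S\<close> depends only on the values of \<open>f\<close> on \<open>S\<close>,
  so a function given only on \<open>S\<close> may be represented by any total extension of it.\<close>

definition C_k_on :: "nat \<Rightarrow> (real \<Rightarrow> real) \<Rightarrow> real set \<Rightarrow> bool"
  where "C_k_on k f S \<longleftrightarrow>
    (\<forall>j<k. \<forall>x\<in>S. (deriv ^^ j) f field_differentiable (at x)) \<and>
    continuous_on S ((deriv ^^ k) f)"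

end

theory Submission
  imports Defs
begin

text \<open>
  The hypothesis says that the quadratic form of the matrix \<open>f[a 1 + u u^T]\<close> is nonnegative, and the
  proof consists in choosing \<open>u\<close> and the test vector \<open>v\<close>.

  If \<open>f\<close> is smooth, scale \<open>u\<close> by \<open>sqrt t\<close> and expand in \<open>t\<close>: the form
  \<open>\<phi> t = (\<Sum>i j. v i * v j * f (a + t * u i * u j))\<close> has \<open>m\<close>-th derivative
  \<open>f^(m) a * (\<Sum>i. v i * u i ^ m)^2\<close> at \<open>0\<close>. When \<open>k < n\<close> and the entries of \<open>u\<close> are distinct, \<open>v\<close> can be
  taken orthogonal to the entrywise powers \<open>u^0, \<dots>, u^(k-1)\<close> but not to \<open>u^k\<close>. Then \<open>\<phi>\<close>
  is nonnegative, its Taylor coefficients below order \<open>k\<close> vanish, and the one of order \<open>k\<close> is a positive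
  multiple of \<open>f^(k) a\<close>, which therefore cannot be negative
  (\<open>preserves_psd_derivative_nonneg\<close>). This is the claim for \<open>C^(n-1)\<close> functions.

  A general \<open>f\<close> is at least continuous, by its two by two minors (\<open>preserves_psd_continuous\<close>), so it has
  iterated antiderivatives \<open>P\<^sub>k\<close>. Let \<open>\<Delta>\<close> be a product of \<open>k < n\<close> difference operators with positive
  steps. Because the family of matrices is stable under raising \<open>a\<close>, averaging \<open>f\<close> over translations
  keeps the forms nonnegative, and \<open>\<Delta> P\<^sub>k\<close> is, up to a factor, a \<open>k\<close>-fold average of \<open>f\<close>
  (\<open>preserves_psd_fdiff\<close>). It is \<open>C^k\<close>, with \<open>k\<close>-th derivative \<open>\<Delta> f\<close>, so the smooth case yields \<open>\<Delta> f \<ge> 0\<close>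
  (\<open>preserves_psd_differences_nonneg\<close>).

  What remains is real analysis. Nonnegative differences of orders up to two make a function
  nondecreasing and convex; with order three it is differentiable, and its derivative inherits the
  property with one order less. Starting from order \<open>n - 1\<close>, the function can be differentiated \<open>n - 3\<close>
  times, and the last derivative is nondecreasing and convex (\<open>differences_nonneg_smooth\<close>).
\<close>

section \<open>Quadratic forms of rank-two perturbations\<close>

text \<open>
  This is positive semidefiniteness of \<open>f[a 1 + u u^T]\<close>, with the matrix indexed by \<open>{..<n}\<close> so that
  test vectors can be written down explicitly, and with the interval as a parameter so that the
  property can be restricted to subintervals.
\<close>

definition preserves_psd :: "nat \<Rightarrow> real set \<Rightarrow> (real \<Rightarrow> real) \<Rightarrow> bool"
  where "preserves_psd n J f \<longleftrightarrow>
    (\<forall>a\<in>J. \<forall>u v. (\<forall>i<n. 0 \<le> u i) \<longrightarrow> (\<forall>i<n. \<forall>j<n. a + u i * u j \<in> J) \<longrightarrow>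
      0 \<le> (\<Sum>i<n. \<Sum>j<n. v i * v j * f (a + u i * u j)))"

lemma preserves_psdD:
  assumes "preserves_psd n J f" "a \<in> J" "\<And>i. i < n \<Longrightarrow> 0 \<le> u i"
    and "\<And>i j. i < n \<Longrightarrow> j < n \<Longrightarrow> a + u i * u j \<in> J"
  shows "0 \<le> (\<Sum>i<n. \<Sum>j<n. v i * v j * f (a + u i * u j))"
  using assms unfolding preserves_psd_def by blast

lemma preserves_psd_subset:
  assumes "preserves_psd n J f" "K \<subseteq> J"
  shows "preserves_psd n K f"
  using assms unfolding preserves_psd_def by blast

lemma quadratic_form_rank_two:
  fixes u x :: "real ^ 'n"
  shows "x \<bullet> ((a *\<^sub>R all_ones + outer_prod u u) *v x) = a * (\<Sum>i\<in>UNIV. x $ i)\<^sup>2 + (u \<bullet> x)\<^sup>2"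
proof -
  have *: "(a *\<^sub>R all_ones + outer_prod u u) *v x
      = (a * (\<Sum>i\<in>UNIV. x $ i)) *\<^sub>R (\<chi> i. 1) + (u \<bullet> x) *\<^sub>R u"
    by (simp add: vec_eq_iff matrix_vector_mult_def all_ones_def outer_prod_def inner_vec_def
        algebra_simps sum.distrib sum_distrib_left)
  have "x \<bullet> (\<chi> i. 1) = (\<Sum>i\<in>UNIV. x $ i)"
    by (simp add: inner_vec_def)
  then show ?thesis
    unfolding * by (simp add: inner_add_right inner_scaleR_right power2_eq_square inner_commute)
qed

lemma rank_rank_two:
  fixes u :: "real ^ 'n"
  shows "rank (a *\<^sub>R all_ones + outer_prod u u :: real ^ 'n ^ 'n) \<le> 2"
proof -
  let ?A = "a *\<^sub>R all_ones + outer_prod u u :: real ^ 'n ^ 'n"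
  have "rows ?A \<subseteq> span {(\<chi> i. 1), u}"
  proof
    fix r assume "r \<in> rows ?A"
    then obtain i where "r = row i ?A" by (auto simp: rows_def)
    then have "r = a *\<^sub>R (\<chi> i. 1) + (u $ i) *\<^sub>R u"
      by (simp add: row_def vec_eq_iff all_ones_def outer_prod_def)
    also have "\<dots> \<in> span {(\<chi> i. 1), u}"
      by (intro span_add span_scale span_base) auto
    finally show "r \<in> span {(\<chi> i. 1), u}" .
  qed
  then have "dim (rows ?A) \<le> card {(\<chi> i. 1) :: real ^ 'n, u}"
    by (rule dim_le_card) simp
  also have "\<dots> \<le> 2" by (simp add: card_insert_if)
  finally show ?thesis by (simp add: row_rank_def)
qed

lemma less_ereal_sqrt:
  assumes "0 \<le> x" "0 \<le> a" "ereal (a + x\<^sup>2) < R"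
  shows "ereal x < ereal_sqrt (R - ereal a)"
proof (cases R)
  case (real r)
  then have "sqrt (x\<^sup>2) < sqrt (r - a)" using assms(3) by (intro real_sqrt_less_mono) auto
  then show ?thesis using real assms(1) by (simp add: ereal_sqrt_def)
next
  case PInf
  then show ?thesis by (simp add: ereal_sqrt_def)
next
  case MInf
  then show ?thesis using assms(3) by simp
qed

text \<open>
  The bounds on \<open>a\<close> and \<open>u\<close> in the matrix formulation follow from the entries lying in \<open>I\<close>: the
  diagonal entry \<open>a + (u i)\<^sup>2 < R\<close> is what bounds \<open>u i\<close>.
\<close>

lemma preserves_psd_of_matrices:
  fixes R :: ereal and f :: "real \<Rightarrow> real"
  assumes I_eq: "I = {x. 0 < x \<and> ereal x < R}"
    and psd: "\<And>(A :: real ^ 'n ^ 'n) a (u :: real ^ 'n).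
        A \<in> psd_mats_rank_le 2 I \<Longrightarrow>
        0 \<le> a \<Longrightarrow> ereal a < R \<Longrightarrow>
        (\<And>i. 0 \<le> u $ i \<and> ereal (u $ i) < ereal_sqrt (R - ereal a)) \<Longrightarrow>
        A = a *\<^sub>R all_ones + outer_prod u u \<Longrightarrow>
        entrywise f A \<in> psd_mats"
  shows "preserves_psd CARD('n) I f"
  unfolding preserves_psd_def
proof (intro ballI allI impI)
  fix a :: real and u v :: "nat \<Rightarrow> real"
  assume a: "a \<in> I" and u: "\<forall>i<CARD('n). 0 \<le> u i"
    and in_I: "\<forall>i<CARD('n). \<forall>j<CARD('n). a + u i * u j \<in> I"
  obtain e where e: "bij_betw e (UNIV :: 'n set) {0..<CARD('n)}"
    using ex_bij_betw_finite_nat[OF finite] by blast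
  then have e_less: "e i < CARD('n)" for i
    using bij_betwE by fastforce
  have reindex: "(\<Sum>i\<in>UNIV. g (e i)) = sum g {..<CARD('n)}" for g :: "nat \<Rightarrow> real"
    using sum.reindex_bij_betw[OF e, of g] by (simp add: atLeast0LessThan)
  define U V :: "real ^ 'n" where "U = (\<chi> i. u (e i))" and "V = (\<chi> i. v (e i))"
  define A where "A = a *\<^sub>R all_ones + outer_prod U U"
  have entry: "A $ i $ j = a + u (e i) * u (e j)" for i j
    by (simp add: A_def all_ones_def outer_prod_def U_def)
  have "A \<in> psd_mats"
    unfolding psd_mats_def
  proof (intro CollectI conjI allI)
    show "transpose A = A"
      by (simp add: transpose_def vec_eq_iff entry mult.commute)
    show "0 \<le> x \<bullet> (A *v x)" for x
      unfolding A_def quadratic_form_rank_two using a I_eq by simp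
  qed
  then have "A \<in> psd_mats_rank_le 2 I"
    using in_I e_less rank_rank_two by (auto simp: psd_mats_rank_le_def entry A_def[symmetric])
      (simp add: A_def rank_rank_two)
  moreover have "0 \<le> U $ i \<and> ereal (U $ i) < ereal_sqrt (R - ereal a)" for i
  proof
    show "0 \<le> U $ i" using u e_less by (simp add: U_def)
    have "a + u (e i) * u (e i) \<in> I" using in_I e_less by blast
    then have "ereal (a + (U $ i)\<^sup>2) < R" by (simp add: I_eq U_def power2_eq_square)
    then show "ereal (U $ i) < ereal_sqrt (R - ereal a)"
      using \<open>0 \<le> U $ i\<close> a I_eq by (intro less_ereal_sqrt) auto
  qed
  ultimately have "entrywise f A \<in> psd_mats"
    using a I_eq by (intro psd[of A a U]) (auto simp: A_def)
  then have "0 \<le> V \<bullet> (entrywise f A *v V)" by (simp add: psd_mats_def)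
  also have "\<dots> = (\<Sum>i\<in>UNIV. \<Sum>j\<in>UNIV. v (e i) * v (e j) * f (a + u (e i) * u (e j)))"
    by (simp add: inner_vec_def matrix_vector_mult_def entrywise_def entry V_def
        sum_distrib_left mult_ac)
  also have "\<dots> = (\<Sum>i\<in>UNIV. \<Sum>j<CARD('n). v (e i) * v j * f (a + u (e i) * u j))"
    by (intro sum.cong refl reindex)
  also have "\<dots> = (\<Sum>i<CARD('n). \<Sum>j<CARD('n). v i * v j * f (a + u i * u j))"
    by (rule reindex[where g = "\<lambda>i. \<Sum>j<CARD('n). v i * v j * f (a + u i * u j)"])
  finally show "0 \<le> (\<Sum>i<CARD('n). \<Sum>j<CARD('n). v i * v j * f (a + u i * u j))" .
qed

section \<open>Two by two minors: monotonicity and continuity\<close>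

lemma psd_form_two:
  fixes p q r :: real
  assumes "\<And>s t. 0 \<le> p * s\<^sup>2 + 2 * q * s * t + r * t\<^sup>2"
  shows "0 \<le> p" "0 \<le> r" "q\<^sup>2 \<le> p * r"
proof -
  show p: "0 \<le> p" and r: "0 \<le> r" using assms[of 1 0] assms[of 0 1] by auto
  show "q\<^sup>2 \<le> p * r"
  proof (cases "r = 0")
    case True
    have "q = 0"
    proof (rule ccontr)
      assume "q \<noteq> 0"
      then show False using assms[of 1 "- (p + 1) / (2 * q)"] True by simp
    qed
    then show ?thesis using True by simp
  next
    case False
    have "0 \<le> r * (p * r - q\<^sup>2)"
      using assms[of r "-q"] by (simp add: algebra_simps power2_eq_square)
    then show ?thesis using r False by (simp add: zero_le_mult_iff)
  qed
qed

text \<open>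
  Test vectors supported on the indices \<open>0\<close> and \<open>1\<close> isolate the leading two by two block.
\<close>

lemma preserves_psd_two:
  assumes f: "preserves_psd n J f" and n: "2 \<le> n"
    and J: "a \<in> J" "a + s * s \<in> J" "a + s * t \<in> J" "a + t * t \<in> J" and "0 \<le> s" "0 \<le> t"
  shows "0 \<le> f (a + s * s)" "(f (a + s * t))\<^sup>2 \<le> f (a + s * s) * f (a + t * t)"
proof -
  have form: "0 \<le> f (a + s * s) * p\<^sup>2 + 2 * f (a + s * t) * p * q + f (a + t * t) * q\<^sup>2" for p q
  proof -
    define u v where "u = (\<lambda>i::nat. if i = 0 then s else t)"
      and "v = (\<lambda>i::nat. if i = 0 then p else if i = 1 then q else 0)"
    have split: "(\<Sum>i<n. v i * F i) = p * F 0 + q * F 1" for F :: "nat \<Rightarrow> real"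
    proof -
      have "(\<Sum>i<n. v i * F i) = (\<Sum>i\<in>{0,1}. v i * F i)"
        using n by (intro sum.mono_neutral_right) (auto simp: v_def)
      then show ?thesis by (simp add: v_def)
    qed
    have "0 \<le> (\<Sum>i<n. \<Sum>j<n. v i * v j * f (a + u i * u j))"
      using assms by (intro preserves_psdD[OF f]) (auto simp: u_def mult.commute)
    also have "\<dots> = (\<Sum>i<n. v i * (\<Sum>j<n. v j * f (a + u i * u j)))"
      by (simp add: sum_distrib_left mult.assoc)
    also have "\<dots> = f (a + s * s) * p\<^sup>2 + 2 * f (a + s * t) * p * q + f (a + t * t) * q\<^sup>2"
      by (simp add: split u_def) (simp add: algebra_simps power2_eq_square)
    finally show ?thesis .
  qed
  show "0 \<le> f (a + s * s)" "(f (a + s * t))\<^sup>2 \<le> f (a + s * s) * f (a + t * t)"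
    using psd_form_two[OF form] by auto
qed

lemma preserves_psd_nonneg:
  assumes "preserves_psd n J f" "2 \<le> n" "x \<in> J"
  shows "0 \<le> f x"
  using preserves_psd_two(1)[OF assms(1,2), of x 0 0] assms(3) by simp

text \<open>
  With \<open>u = (0, sqrt (y - x))\<close> the minor is \<open>f x * f y - (f x)\<^sup>2\<close>.
\<close>

lemma preserves_psd_mono:
  assumes f: "preserves_psd n J f" "2 \<le> n" and "x \<in> J" "y \<in> J" "x \<le> y"
  shows "f x \<le> f y"
proof -
  have "(f x)\<^sup>2 \<le> f x * f y"
    using preserves_psd_two(2)[OF f, of x 0 "sqrt (y - x)"] assms by simp
  then show ?thesis
    using preserves_psd_nonneg[OF f assms(3)] preserves_psd_nonneg[OF f assms(4)]
    by (cases "f x = 0") (auto simp: power2_eq_square)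
qed

text \<open>
  A monotone function can only fail to be continuous by a jump. Let \<open>L\<close> and \<open>U\<close> be its left and right
  limits at \<open>x\<close>. Relative to a base point left of \<open>x\<close>, the minors bound \<open>f\<close> at a geometric mean by the
  geometric mean of the values. With the mean and the larger point slightly right of \<open>x\<close> and the
  smaller point left of \<open>x\<close>, this gives \<open>U\<^sup>2 \<le> L * U\<close>, which leaves no room for a jump.
\<close>

lemma preserves_psd_continuous:
  assumes f: "preserves_psd n J f" "2 \<le> n" and J: "open J" "is_interval J" and x: "x \<in> J"
  shows "isCont f x"
proof -
  note nonneg = preserves_psd_nonneg[OF f] and mono = preserves_psd_mono[OF f]
  obtain e where e: "e > 0" "\<And>y. \<bar>y - x\<bar> < e \<Longrightarrow> y \<in> J"
    using J(1) x by (metis open_dist dist_real_def)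
  define L U where "L = (SUP y\<in>J \<inter> {..<x}. f y)" and "U = (INF y\<in>J \<inter> {x<..}. f y)"
  have "x - e/2 \<in> J \<inter> {..<x}" "x + e/2 \<in> J \<inter> {x<..}" using e by auto
  then have ne: "J \<inter> {..<x} \<noteq> {}" "J \<inter> {x<..} \<noteq> {}" by blast+
  have bdd: "bdd_above (f ` (J \<inter> {..<x}))" "bdd_below (f ` (J \<inter> {x<..}))"
    using mono x by (auto intro!: bdd_aboveI2[where M = "f x"] bdd_belowI2[where m = "f x"])
  have L_upper: "f y \<le> L" if "y \<in> J" "y < x" for y
    unfolding L_def using that bdd by (intro cSUP_upper) auto
  have U_lower: "U \<le> f y" if "y \<in> J" "x < y" for y
    unfolding U_def using that bdd by (intro cINF_lower) auto
  have "L \<le> f x" "f x \<le> U"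
    unfolding L_def U_def using ne mono x by (auto intro!: cSUP_least cINF_greatest)
  have "0 \<le> L" using nonneg ne(1) L_upper by force
  have key: "U\<^sup>2 \<le> L * f y" if y: "y \<in> J" "x < y" for y
  proof -
    obtain d where d: "0 < d" "d < e" "d < y - x" using e(1) y(2) dense[of 0 "min e (y - x)"] by auto
    have xd: "x + d \<in> J" "x + d \<le> y" using d e by auto
    \<comment> \<open>Based at \<open>x - c\<close>, the increments \<open>c / 2\<close>, \<open>2 * c\<close>, \<open>8 * c\<close> are in geometric
      progression, and only the first one stays to the left of \<open>x\<close>.\<close>
    define c where "c = d / 8"
    define s where "s = sqrt (c / 2)"
    have "c > 0" using d by (simp add: c_def)
    have "0 \<le> s" "s * s = c / 2"
      using \<open>c > 0\<close> by (simp_all add: s_def)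
    then have st: "s * s = c / 2" "(4 * s) * (4 * s) = 8 * c" "s * (4 * s) = 2 * c"
      by auto
    have inJ: "x - c \<in> J" "x - c + c/2 \<in> J" "x - c + 2 * c \<in> J" "x - c + 8 * c \<in> J"
      using d \<open>c > 0\<close> by (auto intro!: e simp: c_def)
    have "U\<^sup>2 \<le> (f (x - c + 2 * c))\<^sup>2"
      using U_lower[OF inJ(3)] \<open>c > 0\<close> \<open>f x \<le> U\<close> nonneg[OF x] by (intro power_mono) auto
    also have "\<dots> \<le> f (x - c + c/2) * f (x - c + 8 * c)"
      using preserves_psd_two(2)[OF f, of "x - c" s "4 * s"] inJ \<open>0 \<le> s\<close>
      unfolding st by simp
    also have "\<dots> \<le> L * f y"
      using \<open>c > 0\<close> inJ y xd \<open>0 \<le> L\<close> nonneg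
      by (intro mult_mono L_upper mono) (auto simp: c_def)
    finally show ?thesis .
  qed
  have "U \<le> L"
  proof (cases "L = 0")
    case True
    obtain y where "y \<in> J \<inter> {x<..}" using ne by blast
    then show ?thesis using key[of y] True by auto
  next
    case False
    then have "L > 0" using \<open>0 \<le> L\<close> by simp
    have "U\<^sup>2 / L \<le> (INF y\<in>J \<inter> {x<..}. f y)"
    proof (rule cINF_greatest[OF ne(2)])
      fix y assume "y \<in> J \<inter> {x<..}"
      then have "U\<^sup>2 \<le> L * f y" using key by auto
      then show "U\<^sup>2 / L \<le> f y"
        using \<open>L > 0\<close> by (simp add: field_simps)
    qed
    then have "U\<^sup>2 / L \<le> U" by (simp only: U_def)
    then have "U * U \<le> U * L" using \<open>L > 0\<close> by (simp add: field_simps power2_eq_square)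
    then show ?thesis using \<open>L > 0\<close> \<open>L \<le> f x\<close> \<open>f x \<le> U\<close> by simp
  qed
  then have "L = f x" "U = f x" using \<open>L \<le> f x\<close> \<open>f x \<le> U\<close> by auto
  show ?thesis
    unfolding continuous_at_eps_delta
  proof (intro allI impI)
    fix \<epsilon> :: real assume "\<epsilon> > 0"
    have "L - \<epsilon> < L" "U < U + \<epsilon>" using \<open>\<epsilon> > 0\<close> by auto
    have "\<exists>y\<in>J \<inter> {..<x}. L - \<epsilon> < f y" "\<exists>z\<in>J \<inter> {x<..}. f z < U + \<epsilon>"
      using \<open>L - \<epsilon> < L\<close> \<open>U < U + \<epsilon>\<close> less_cSUP_iff[OF ne(1) bdd(1)] cINF_less_iff[OF ne(2) bdd(2)]
      by (simp_all only: L_def U_def)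
    then obtain y z where y: "y \<in> J" "y < x" "L - \<epsilon> < f y"
      and z: "z \<in> J" "x < z" "f z < U + \<epsilon>" by blast
    show "\<exists>d>0. \<forall>x'. dist x' x < d \<longrightarrow> dist (f x') (f x) < \<epsilon>"
    proof (intro exI[of _ "Min {e, x - y, z - x}"] conjI allI impI)
      show "0 < Min {e, x - y, z - x}" using e y z by simp
      fix w assume "dist w x < Min {e, x - y, z - x}"
      then have "w \<in> J" "y \<le> w" "w \<le> z" using e by (auto simp: dist_real_def)
      then have "f y \<le> f w" "f w \<le> f z" using mono y z by auto
      then show "dist (f w) (f x) < \<epsilon>"
        using y z \<open>L = f x\<close> \<open>U = f x\<close> by (auto simp: dist_real_def)
    qed
  qed
qed

section \<open>The smooth case\<close>

lemma DERIV_double_sum: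
  assumes "\<And>i j. i < n \<Longrightarrow> j < n \<Longrightarrow> DERIV (F i j) t :> F' i j"
  shows "DERIV (\<lambda>t. \<Sum>i<n. \<Sum>j<n. F i j t :: real) t :> (\<Sum>i<n. \<Sum>j<n. F' i j)"
  by (intro DERIV_sum) (use assms in auto)

text \<open>
  For \<open>u i = 2 ^ i\<close> the sum \<open>\<Sum>i<n. v i * u i ^ m\<close> is the value at \<open>2 ^ m\<close> of the polynomial with
  coefficients \<open>v\<close>. So it suffices to take the polynomial with roots \<open>2 ^ 0, \<dots>, 2 ^ (k - 1)\<close>, whose
  degree \<open>k\<close> is less than \<open>n\<close>.
\<close>

lemma annihilating_weights:
  assumes "k < n"
  obtains v :: "nat \<Rightarrow> real"
  where "\<And>m. m < k \<Longrightarrow> (\<Sum>i<n. v i * (2 ^ i) ^ m) = 0" "(\<Sum>i<n. v i * (2 ^ i) ^ k) \<noteq> 0"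
proof -
  define p :: "real poly" where "p = (\<Prod>m<k. [:- (2 ^ m), 1:])"
  have deg: "degree p = k" unfolding p_def by (subst degree_prod_eq_sum_degree) auto
  have eval: "(\<Sum>i<n. coeff p i * (2 ^ i) ^ m) = (\<Prod>l<k. 2 ^ m - 2 ^ l)" for m
  proof -
    have "(\<Sum>i<n. coeff p i * (2 ^ i) ^ m) = (\<Sum>i<n. coeff p i * (2 ^ m) ^ i)"
      by (simp add: power_mult[symmetric] mult.commute)
    also have "\<dots> = (\<Sum>i\<le>degree p. coeff p i * (2 ^ m) ^ i)"
      using assms deg by (intro sum.mono_neutral_right) (auto simp: coeff_eq_0)
    also have "\<dots> = poly p (2 ^ m)" by (simp add: poly_altdef)
    also have "\<dots> = (\<Prod>l<k. 2 ^ m - 2 ^ l)" by (simp add: p_def poly_prod)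
    finally show ?thesis .
  qed
  show ?thesis
  proof (rule that[of "coeff p"])
    show "(\<Sum>i<n. coeff p i * (2 ^ i) ^ m) = 0" if "m < k" for m
      unfolding eval using that by (intro prod_zero) auto
    show "(\<Sum>i<n. coeff p i * (2 ^ i) ^ k) \<noteq> 0"
      unfolding eval by auto
  qed
qed

text \<open>
  The functions \<open>\<phi> m\<close> in the proof are the successive derivatives in \<open>t\<close> of the quadratic form for
  \<open>sqrt t *\<^sub>R u\<close>, with \<open>u\<close> and \<open>v\<close> as in \<open>annihilating_weights\<close>. Those of order less than \<open>k\<close>
  vanish at \<open>0\<close>, so Taylor's theorem equates the form to \<open>\<phi> k s * t ^ k / fact k\<close> for some \<open>0 < s \<le> t\<close>.
  The derivatives of \<open>g 0\<close> are given as a sequence rather than by \<open>deriv\<close>, because for differences of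
  antiderivatives they are known explicitly.
\<close>

lemma preserves_psd_derivative_nonneg:
  fixes g :: "nat \<Rightarrow> real \<Rightarrow> real"
  assumes g: "preserves_psd n J (g 0)" and k: "k < n" and J: "open J" "x \<in> J"
    and deriv: "\<And>j y. j < k \<Longrightarrow> y \<in> J \<Longrightarrow> DERIV (g j) y :> g (Suc j) y"
    and cont: "isCont (g k) x"
  shows "0 \<le> g k x"
proof (rule ccontr)
  assume neg: "\<not> 0 \<le> g k x"
  obtain v :: "nat \<Rightarrow> real" where v: "\<And>m. m < k \<Longrightarrow> (\<Sum>i<n. v i * (2 ^ i) ^ m) = 0"
    and vk: "(\<Sum>i<n. v i * (2 ^ i) ^ k) \<noteq> 0"
    using annihilating_weights[OF k] by metis
  define c :: "nat \<Rightarrow> nat \<Rightarrow> real" where "c i j = 2 ^ i * 2 ^ j" for i j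
  define \<phi> where "\<phi> m t = (\<Sum>i<n. \<Sum>j<n. v i * v j * c i j ^ m * g m (x + t * c i j))" for m t
  have \<phi>_0: "\<phi> m 0 = g m x * (\<Sum>i<n. v i * (2 ^ i) ^ m)\<^sup>2" for m
    by (simp add: \<phi>_def c_def power2_eq_square sum_product sum_distrib_left power_mult_distrib mult_ac)
  obtain e where e: "e > 0" "\<And>y. \<bar>y - x\<bar> < e \<Longrightarrow> y \<in> J"
    using J by (metis open_dist dist_real_def)
  \<comment> \<open>All factors \<open>c i j\<close> are at most \<open>4 ^ n\<close>, so the arguments stay in \<open>J\<close> while \<open>t < T\<close>.\<close>
  define T where "T = e / 4 ^ n"
  have "T > 0" using e by (simp add: T_def)
  have inJ: "x + t * c i j \<in> J" if "0 \<le> t" "t < T" "i < n" "j < n" for t i j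
  proof -
    have "c i j \<le> 2 ^ n * 2 ^ n"
      unfolding c_def using that by (intro mult_mono power_increasing) auto
    also have "\<dots> = (4::real) ^ n" by (simp add: power_mult_distrib[symmetric])
    finally have "t * c i j \<le> t * 4 ^ n" using that by (intro mult_left_mono)
    also have "\<dots> < e" using that by (simp add: T_def field_simps)
    finally show ?thesis using that by (intro e) (simp add: c_def)
  qed
  have \<phi>_deriv: "DERIV (\<phi> m) t :> \<phi> (Suc m) t" if "m < k" "0 \<le> t" "t < T" for m t
    unfolding \<phi>_def
  proof (rule DERIV_double_sum)
    fix i j assume "i < n" "j < n"
    then have "DERIV (g m) (x + t * c i j) :> g (Suc m) (x + t * c i j)"
      using that by (intro deriv inJ)
    then have "DERIV (\<lambda>t. g m (x + t * c i j)) t :> g (Suc m) (x + t * c i j) * c i j"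
      by (rule DERIV_chain2) (auto intro!: derivative_eq_intros)
    then show "DERIV (\<lambda>t. v i * v j * c i j ^ m * g m (x + t * c i j)) t
        :> v i * v j * c i j ^ Suc m * g (Suc m) (x + t * c i j)"
      by (auto intro!: derivative_eq_intros)
  qed
  have \<phi>_nonneg: "0 \<le> \<phi> 0 t" if "0 \<le> t" "t < T" for t
  proof -
    define u :: "nat \<Rightarrow> real" where "u i = sqrt t * 2 ^ i" for i
    have uu: "u i * u j = t * c i j" for i j
      using that by (simp add: u_def c_def algebra_simps)
    have "0 \<le> (\<Sum>i<n. \<Sum>j<n. v i * v j * g 0 (x + u i * u j))"
      using J that by (intro preserves_psdD[OF g]) (auto simp: uu inJ, auto simp: u_def)
    then show ?thesis by (simp add: \<phi>_def uu)
  qed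
  have inner: "isCont (\<lambda>t. g k (x + t * c i j)) 0" for i j
    by (rule isCont_o2[where f = "\<lambda>t. x + t * c i j" and g = "g k"]) (simp_all add: cont)
  have "isCont (\<phi> k) 0"
    unfolding \<phi>_def by (rule continuous_sum, rule continuous_sum, rule continuous_mult_left, rule inner)
  moreover have "\<phi> k 0 < 0"
    unfolding \<phi>_0 using neg vk by (simp add: mult_neg_pos)
  ultimately have "\<forall>\<^sub>F t in at 0. \<phi> k t < 0"
    by (metis isCont_def order_tendstoD(2))
  then obtain d where d: "d > 0" "\<And>t. t \<noteq> 0 \<Longrightarrow> \<bar>t\<bar> < d \<Longrightarrow> \<phi> k t < 0"
    by (auto simp: eventually_at dist_real_def)
  define h where "h = min d T / 2"
  have h: "0 < h" "h < d" "h < T" using d \<open>T > 0\<close> by (auto simp: h_def)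
  obtain t where t: "0 < t" "t \<le> h"
    and Taylor: "\<phi> 0 h = (\<Sum>m<k. \<phi> m 0 / fact m * h ^ m) + \<phi> k t / fact k * h ^ k"
    using Maclaurin2[OF h(1), of \<phi> "\<phi> 0" k] \<phi>_deriv h by auto
  have "(\<Sum>m<k. \<phi> m 0 / fact m * h ^ m) = 0" by (intro sum.neutral) (simp add: \<phi>_0 v)
  then have "\<phi> 0 h < 0" unfolding Taylor using d(2)[of t] t h
    by (simp add: mult_neg_pos divide_neg_pos)
  then show False using \<phi>_nonneg[of h] h by simp
qed

section \<open>Iterated differences and antiderivatives\<close>

text \<open>
  The steps are arbitrary positive numbers, one for each order. Mixed steps are what makes the passage
  to the derivative possible: one step can tend to zero while the others stay fixed.
\<close>

fun fdiff :: "real list \<Rightarrow> (real \<Rightarrow> real) \<Rightarrow> real \<Rightarrow> real" where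
  "fdiff [] f x = f x"
| "fdiff (h # hs) f x = fdiff hs f (x + h) - fdiff hs f x"

lemma fdiff_Nil: "fdiff [] f = f"
  by (rule ext) simp

lemma fdiff_Cons: "fdiff (h # hs) f = (\<lambda>x. fdiff hs f (x + h) - fdiff hs f x)"
  by (rule ext) simp

lemma sum_list_nonneg_of_pos: "(\<And>h. h \<in> set hs \<Longrightarrow> 0 < h) \<Longrightarrow> 0 \<le> sum_list hs"
  for hs :: "real list"
  by (intro sum_list_nonneg) (simp add: less_imp_le)

lemma fdiff_increment: "fdiff hs (\<lambda>y. f (y + s) - f y) x = fdiff hs f (x + s) - fdiff hs f x"
proof (induction hs arbitrary: x)
  case (Cons h hs)
  have "x + h + s = x + s + h" by simp
  then show ?case by (simp only: fdiff.simps Cons.IH)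
qed simp

lemma DERIV_fdiff:
  assumes "is_interval J" "\<And>y. y \<in> J \<Longrightarrow> DERIV f y :> g y"
    and "\<And>h. h \<in> set hs \<Longrightarrow> 0 < h" "x \<in> J" "x + sum_list hs \<in> J"
  shows "DERIV (fdiff hs f) x :> fdiff hs g x"
  using assms(3-)
proof (induction hs arbitrary: x)
  case Nil
  then show ?case using assms(2) by (simp add: fdiff_Nil)
next
  case (Cons h hs)
  have "0 < h" "0 \<le> sum_list hs" using Cons.prems(1) by (auto intro!: sum_list_nonneg_of_pos)
  then have "x + h \<in> J" "x + sum_list hs \<in> J"
    using Cons.prems(2,3) by (auto intro: mem_is_interval_1_I[OF assms(1) Cons.prems(2,3)])
  then have "DERIV (fdiff hs f) (x + h) :> fdiff hs g (x + h)" "DERIV (fdiff hs f) x :> fdiff hs g x"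
    using Cons.prems by (auto intro!: Cons.IH simp: add.assoc)
  then show ?case
    unfolding fdiff_Cons fdiff.simps by (auto simp: DERIV_shift intro!: DERIV_diff)
qed

lemma isCont_fdiff:
  assumes "is_interval J" "\<And>y. y \<in> J \<Longrightarrow> isCont f y"
    and "\<And>h. h \<in> set hs \<Longrightarrow> 0 < h" "x \<in> J" "x + sum_list hs \<in> J"
  shows "isCont (fdiff hs f) x"
  using assms(3-)
proof (induction hs arbitrary: x)
  case Nil
  then show ?case using assms(2) by (simp add: fdiff_Nil)
next
  case (Cons h hs)
  have "0 < h" "0 \<le> sum_list hs" using Cons.prems(1) by (auto intro!: sum_list_nonneg_of_pos)
  then have "x + h \<in> J" "x + sum_list hs \<in> J"
    using Cons.prems(2,3) by (auto intro: mem_is_interval_1_I[OF assms(1) Cons.prems(2,3)])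
  then have "isCont (fdiff hs f) (x + h)" "isCont (fdiff hs f) x"
    using Cons.prems by (auto intro!: Cons.IH simp: add.assoc)
  then show ?case
    unfolding fdiff_Cons
    by (auto intro!: continuous_diff simp: isCont_o2[where f = "\<lambda>x. x + h" and g = "fdiff hs f"])
qed

text \<open>
  The increment \<open>G (y + h) - G y\<close> is the integral of \<open>g\<close> over \<open>[y, y + h]\<close>, so its quadratic form is an
  integral over \<open>s \<in> [0, h]\<close> of the forms of \<open>g\<close> at base points \<open>a + s\<close>. In differential form: the form of
  \<open>G\<close> at \<open>a + s\<close> is nondecreasing in \<open>s\<close>.
\<close>

lemma preserves_psd_increment:
  assumes psd: "preserves_psd n {\<alpha><..<\<beta>} g"
    and deriv: "\<And>y. y \<in> {\<alpha><..<\<beta>} \<Longrightarrow> DERIV G y :> g y" and h: "0 < h"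
  shows "preserves_psd n {\<alpha><..<\<beta> - h} (\<lambda>y. G (y + h) - G y)"
  unfolding preserves_psd_def
proof (intro ballI allI impI)
  fix a and u v :: "nat \<Rightarrow> real"
  assume a: "a \<in> {\<alpha><..<\<beta> - h}" and u: "\<forall>i<n. 0 \<le> u i"
    and inJ: "\<forall>i<n. \<forall>j<n. a + u i * u j \<in> {\<alpha><..<\<beta> - h}"
  define \<phi> where "\<phi> s = (\<Sum>i<n. \<Sum>j<n. v i * v j * G (a + s + u i * u j))" for s
  have "\<phi> 0 \<le> \<phi> h"
  proof (rule DERIV_nonneg_imp_nondecreasing[where f = \<phi>])
    show "0 \<le> h" using h by simp
    fix s assume s: "0 \<le> s" "s \<le> h"
    have shift: "a + s \<in> {\<alpha><..<\<beta>}" "\<And>i j. i < n \<Longrightarrow> j < n \<Longrightarrow> a + s + u i * u j \<in> {\<alpha><..<\<beta>}"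
      using s a inJ by fastforce+
    have "DERIV \<phi> s :> (\<Sum>i<n. \<Sum>j<n. v i * v j * g (a + s + u i * u j))"
      unfolding \<phi>_def
    proof (rule DERIV_double_sum)
      fix i j assume "i < n" "j < n"
      then have "DERIV (\<lambda>s. G (a + s + u i * u j)) s :> g (a + s + u i * u j) * 1"
        by (intro DERIV_chain2[OF deriv] shift) (auto intro!: derivative_eq_intros)
      then show "DERIV (\<lambda>s. v i * v j * G (a + s + u i * u j)) s :> v i * v j * g (a + s + u i * u j)"
        by (auto intro!: derivative_eq_intros)
    qed
    moreover have "0 \<le> (\<Sum>i<n. \<Sum>j<n. v i * v j * g (a + s + u i * u j))"
      using shift u by (intro preserves_psdD[OF psd]) auto
    ultimately show "\<exists>y. DERIV \<phi> s :> y \<and> 0 \<le> y" by blast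
  qed
  then show "0 \<le> (\<Sum>i<n. \<Sum>j<n. v i * v j * (G (a + u i * u j + h) - G (a + u i * u j)))"
    by (simp add: \<phi>_def right_diff_distrib sum_subtractf add_ac)
qed

text \<open>
  Each step of the induction integrates once and takes the difference once. The interval loses the
  length of the step at its right end.
\<close>

lemma preserves_psd_fdiff:
  assumes psd: "preserves_psd n {\<alpha><..<\<beta>} (P 0)"
    and deriv: "\<And>j y. y \<in> {\<alpha><..<\<beta>} \<Longrightarrow> DERIV (P (Suc j)) y :> P j y"
    and "\<And>h. h \<in> set hs \<Longrightarrow> 0 < h"
  shows "preserves_psd n {\<alpha><..<\<beta> - sum_list hs} (fdiff hs (P (length hs)))"
  using assms(3)
proof (induction hs)
  case Nil
  then show ?case using psd by (simp add: fdiff_Nil)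
next
  case (Cons h hs)
  have pos: "0 < h" "0 \<le> sum_list hs" "\<And>h. h \<in> set hs \<Longrightarrow> 0 < h"
    using Cons.prems by (auto intro!: sum_list_nonneg_of_pos)
  have "preserves_psd n {\<alpha><..<\<beta> - sum_list hs - h}
      (\<lambda>y. fdiff hs (P (Suc (length hs))) (y + h) - fdiff hs (P (Suc (length hs))) y)"
  proof (rule preserves_psd_increment)
    show "preserves_psd n {\<alpha><..<\<beta> - sum_list hs} (fdiff hs (P (length hs)))"
      using Cons by simp
    show "DERIV (fdiff hs (P (Suc (length hs)))) y :> fdiff hs (P (length hs)) y"
      if "y \<in> {\<alpha><..<\<beta> - sum_list hs}" for y
      using that pos by (intro DERIV_fdiff[where J = "{\<alpha><..<\<beta>}"] deriv) (auto simp: is_interval_oo)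
  qed (fact pos)
  then show ?case by (simp add: fdiff_Cons diff_diff_eq add.commute)
qed

lemma iterated_antiderivatives:
  fixes f :: "real \<Rightarrow> real"
  assumes "continuous_on {\<alpha>..\<beta>} f"
  obtains P :: "nat \<Rightarrow> real \<Rightarrow> real" where "P 0 = f"
    "\<And>j y. y \<in> {\<alpha><..<\<beta>} \<Longrightarrow> DERIV (P (Suc j)) y :> P j y"
proof -
  define P where "P = rec_nat f (\<lambda>_ g x. integral {\<alpha>..x} g)"
  have P: "P 0 = f" "P (Suc j) = (\<lambda>x. integral {\<alpha>..x} (P j))" for j
    by (simp_all add: P_def)
  have within: "(P (Suc j) has_real_derivative P j y) (at y within {\<alpha>..\<beta>})"
    if "continuous_on {\<alpha>..\<beta>} (P j)" "y \<in> {\<alpha>..\<beta>}" for j y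
    unfolding P(2) using that by (rule integral_has_real_derivative)
  have cont: "continuous_on {\<alpha>..\<beta>} (P j)" for j
  proof (induction j)
    case 0
    then show ?case using assms by (simp add: P(1))
  next
    case (Suc j)
    then show ?case by (intro DERIV_continuous_on[OF within])
  qed
  show ?thesis
  proof (rule that[of P, OF P(1)])
    fix j y assume y: "y \<in> {\<alpha><..<\<beta>}"
    then have "at y within {\<alpha>..\<beta>} = at y" by (intro at_within_interior) simp
    then show "DERIV (P (Suc j)) y :> P j y" using within[OF cont, of y j] y by simp
  qed
qed

text \<open>
  Orders below \<open>N\<close> are included because the analysis below uses monotonicity and convexity of the
  function together with the difference of top order.
\<close>

definition differences_nonneg :: "nat \<Rightarrow> real set \<Rightarrow> (real \<Rightarrow> real) \<Rightarrow> bool"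
  where "differences_nonneg N I f \<longleftrightarrow>
    (\<forall>hs x. length hs \<le> N \<longrightarrow> (\<forall>h\<in>set hs. 0 < h) \<longrightarrow> x \<in> I \<longrightarrow> x + sum_list hs \<in> I \<longrightarrow>
      0 \<le> fdiff hs f x)"

text \<open>
  For \<open>k\<close> steps, the smooth case applies to \<open>fdiff hs (P k)\<close>, whose derivatives are the differences of
  the lower antiderivatives, ending with \<open>fdiff hs f\<close>.
\<close>

lemma preserves_psd_differences_nonneg:
  assumes psd: "preserves_psd n I f" and n: "2 \<le> n" and I: "open I" "is_interval I"
  shows "differences_nonneg (n - 1) I f"
  unfolding differences_nonneg_def
proof (intro allI impI)
  fix hs x assume len: "length hs \<le> n - 1" and "\<forall>h\<in>set hs. 0 < h"
    and x: "x \<in> I" "x + sum_list hs \<in> I"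
  then have pos: "\<And>h. h \<in> set hs \<Longrightarrow> 0 < h" by blast
  then have "0 \<le> sum_list hs" by (rule sum_list_nonneg_of_pos)
  obtain d where d: "d > 0" "\<And>y. \<bar>y - x\<bar> < d \<Longrightarrow> y \<in> I"
    using I(1) x(1) by (metis open_dist dist_real_def)
  obtain e where e: "e > 0" "\<And>y. \<bar>y - (x + sum_list hs)\<bar> < e \<Longrightarrow> y \<in> I"
    using I(1) x(2) by (metis open_dist dist_real_def)
  \<comment> \<open>Antiderivatives are built by integration from a left endpoint, hence on a compact subinterval.\<close>
  define \<alpha> \<beta> where "\<alpha> = x - d / 2" and "\<beta> = x + sum_list hs + e / 2"
  have "\<alpha> \<in> I" "\<beta> \<in> I" using d e by (auto simp: \<alpha>_def \<beta>_def)
  then have sub: "{\<alpha>..\<beta>} \<subseteq> I"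
    using mem_is_interval_1_I[OF I(2)] by (meson atLeastAtMost_iff subsetI)
  define J where "J = {\<alpha><..<\<beta> - sum_list hs}"
  have "x \<in> J" using d e by (simp add: J_def \<alpha>_def \<beta>_def)
  have isCont_f: "isCont f y" if "y \<in> I" for y
    using preserves_psd_continuous[OF psd n I that] .
  then have "continuous_on {\<alpha>..\<beta>} f"
    using sub by (intro continuous_at_imp_continuous_on) auto
  then obtain P where P: "P 0 = f" "\<And>j y. y \<in> {\<alpha><..<\<beta>} \<Longrightarrow> DERIV (P (Suc j)) y :> P j y"
    using iterated_antiderivatives by blast
  let ?k = "length hs"
  define g where "g j = fdiff hs (P (?k - j))" for j
  have "0 \<le> g ?k x"
  proof (rule preserves_psd_derivative_nonneg[where g = g and k = ?k and J = J and n = n])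
    show "preserves_psd n J (g 0)"
      unfolding g_def J_def diff_zero
    proof (rule preserves_psd_fdiff[where P = P])
      have "{\<alpha><..<\<beta>} \<subseteq> I" using sub by (auto simp: subset_iff)
      then show "preserves_psd n {\<alpha><..<\<beta>} (P 0)"
        unfolding P(1) by (rule preserves_psd_subset[OF psd])
    qed (use P(2) pos in auto)
    show "?k < n" using len n by simp
    show "open J" "x \<in> J" using \<open>x \<in> J\<close> by (auto simp: J_def)
    show "DERIV (g j) y :> g (Suc j) y" if "j < ?k" "y \<in> J" for j y
    proof -
      have "?k - j = Suc (?k - Suc j)" using that by simp
      then show ?thesis
        unfolding g_def \<open>?k - j = Suc (?k - Suc j)\<close> using that \<open>0 \<le> sum_list hs\<close>
        by (intro DERIV_fdiff[where J = "{\<alpha><..<\<beta>}"] P(2) pos) (auto simp: J_def is_interval_oo)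
    qed
    show "isCont (g ?k) x"
      using isCont_fdiff[OF I(2) isCont_f pos x] by (simp add: g_def P(1))
  qed
  then show "0 \<le> fdiff hs f x" by (simp add: g_def P(1))
qed

section \<open>Nonnegative differences imply smoothness\<close>

lemma differences_nonnegD:
  assumes "differences_nonneg N I f" "length hs \<le> N" "\<And>h. h \<in> set hs \<Longrightarrow> 0 < h"
    and "x \<in> I" "x + sum_list hs \<in> I"
  shows "0 \<le> fdiff hs f x"
  using assms unfolding differences_nonneg_def by blast

lemma differences_nonneg_mono_order:
  assumes "differences_nonneg N I f" "M \<le> N"
  shows "differences_nonneg M I f"
  using assms unfolding differences_nonneg_def by (meson order_trans)

lemma differences_nonneg_imp_nonneg:
  assumes "differences_nonneg N I f" "x \<in> I"
  shows "0 \<le> f x"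
  using differences_nonnegD[OF assms(1), of "[]" x] assms(2) by simp

lemma differences_nonneg_imp_mono:
  assumes "differences_nonneg N I f" "1 \<le> N" "x \<in> I" "y \<in> I" "x \<le> y"
  shows "f x \<le> f y"
  using differences_nonnegD[OF assms(1), of "[y - x]" x] assms(2-)
  by (cases "x = y") auto

lemma differences_nonneg_increment_mono:
  assumes f: "differences_nonneg N I f" "2 \<le> N" and "0 < h" "x \<in> I" "y + h \<in> I" "x \<le> y"
  shows "f (x + h) - f x \<le> f (y + h) - f y"
proof (cases "x = y")
  case False
  then have "\<And>d. d \<in> set [y - x, h] \<Longrightarrow> 0 < d" using assms by auto
  then show ?thesis
    using differences_nonnegD[OF f(1), of "[y - x, h]" x] assms by (simp add: add_ac)
qed simp

text \<open>
  Convexity from monotone increments, with no continuity available beforehand. Divide \<open>[x, z]\<close> into \<open>m\<close>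
  steps of length \<open>\<delta>\<close> and fit as many such steps as possible into \<open>[z, y]\<close>. Every increment left of
  \<open>z\<close> is at most the last one before \<open>z\<close>, and every increment right of \<open>z\<close> is at least that. Monotonicity
  of \<open>f\<close> takes care of the incomplete last step, whose effect disappears as \<open>m \<rightarrow> \<infinity>\<close>.
\<close>

lemma differences_nonneg_slope:
  assumes f: "differences_nonneg N I f" "2 \<le> N" and I: "is_interval I"
    and x: "x \<in> I" "y \<in> I" "x < z" "z < y"
  shows "(f z - f x) * (y - z) \<le> (f y - f z) * (z - x)"
proof -
  have inI: "w \<in> I" if "x \<le> w" "w \<le> y" for w
    using I x(1,2) that unfolding is_interval_1 by blast
  note mono = differences_nonneg_imp_mono[OF f(1)]
    and incr = differences_nonneg_increment_mono[OF f]
  define p q where "p = z - x" and "q = y - z"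
  have pq: "p > 0" "q > 0" using x by (auto simp: p_def q_def)
  define D where "D = f z - f x"
  have "D \<ge> 0" using mono[of x z] inI x f(2) by (simp add: D_def)
  have approx: "D * (q * m - p) \<le> (f y - f z) * p * m" if m: "0 < m" for m :: nat
  proof -
    define \<delta> where "\<delta> = p / m"
    have \<delta>: "\<delta> > 0" "m * \<delta> = p" using pq m by (auto simp: \<delta>_def)
    define d where "d = f z - f (z - \<delta>)"
    have "\<delta> \<le> p" using pq m by (simp add: \<delta>_def field_simps)
    then have z\<delta>: "x \<le> z - \<delta>" by (simp add: p_def)
    have "d \<ge> 0" using mono[of "z - \<delta>" z] inI x f(2) \<delta> z\<delta> by (simp add: d_def)
    define l where "l = nat \<lfloor>q / \<delta>\<rfloor>"
    have "real l = of_int \<lfloor>q / \<delta>\<rfloor>" using pq \<delta> by (simp add: l_def)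
    then have "real l \<le> q / \<delta>" "q / \<delta> < real l + 1" by linarith+
    then have l: "l * \<delta> \<le> q" "q < (l + 1) * \<delta>"
      using \<delta> by (simp_all add: field_simps)
    have "D = (\<Sum>j<m. f (x + (Suc j) * \<delta>) - f (x + j * \<delta>))"
      using \<delta> unfolding sum_lessThan_telescope[where f = "\<lambda>j. f (x + real j * \<delta>)"]
      by (simp add: D_def p_def)
    also have "\<dots> \<le> (\<Sum>j<m. d)"
    proof (rule sum_mono)
      fix j assume "j \<in> {..<m}"
      then have "(j + 1) * \<delta> \<le> m * \<delta>" using \<delta> by (intro mult_right_mono) auto
      then have j: "x + j * \<delta> \<le> z - \<delta>" "x \<le> x + j * \<delta>"
        using \<delta> by (auto simp: p_def algebra_simps)
      then have "f (x + j * \<delta> + \<delta>) - f (x + j * \<delta>) \<le> f (z - \<delta> + \<delta>) - f (z - \<delta>)"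
        using x \<delta> by (intro incr inI) auto
      then show "f (x + (Suc j) * \<delta>) - f (x + j * \<delta>) \<le> d"
        by (simp add: d_def algebra_simps)
    qed
    finally have D_le: "D \<le> m * d" by simp
    have "l * d = (\<Sum>j<l. d)" by simp
    also have "\<dots> \<le> (\<Sum>j<l. f (z + (Suc j) * \<delta>) - f (z + j * \<delta>))"
    proof (rule sum_mono)
      fix j assume "j \<in> {..<l}"
      then have "(j + 1) * \<delta> \<le> l * \<delta>" using \<delta> by (intro mult_right_mono) auto
      then have j: "z + j * \<delta> + \<delta> \<le> y" "0 \<le> j * \<delta>"
        using \<delta> l(1) by (auto simp: q_def algebra_simps)
      then have "f (z - \<delta> + \<delta>) - f (z - \<delta>) \<le> f (z + j * \<delta> + \<delta>) - f (z + j * \<delta>)"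
        using x \<delta>(1) z\<delta> by (intro incr inI) linarith+
      then show "d \<le> f (z + (Suc j) * \<delta>) - f (z + j * \<delta>)"
        by (simp add: d_def algebra_simps)
    qed
    also have "\<dots> = f (z + l * \<delta>) - f z"
      unfolding sum_lessThan_telescope[where f = "\<lambda>j. f (z + real j * \<delta>)"] by simp
    also have "\<dots> \<le> f y - f z"
    proof -
      have "0 \<le> l * \<delta>" using \<delta> by simp
      then show ?thesis using mono[of "z + l * \<delta>" y] inI x l(1) f(2) by (simp add: q_def)
    qed
    finally have "l * d \<le> f y - f z" .
    have "q * m - p < l * p"
    proof -
      have "q * m < (l + 1) * \<delta> * m" using l(2) m by (intro mult_strict_right_mono) auto
      also have "\<dots> = (l + 1) * p" using \<delta>(2) by (simp add: mult_ac)
      finally show ?thesis by (simp add: algebra_simps)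
    qed
    then have "D * (q * m - p) \<le> D * (l * p)" using \<open>D \<ge> 0\<close> by (intro mult_left_mono) auto
    also have "\<dots> \<le> (m * d) * (l * p)" using D_le pq by (intro mult_right_mono) auto
    also have "\<dots> = (l * d) * (p * m)" by (simp add: mult_ac)
    also have "\<dots> \<le> (f y - f z) * (p * m)"
      using \<open>l * d \<le> f y - f z\<close> pq by (intro mult_right_mono) auto
    finally show ?thesis by (simp add: mult_ac)
  qed
  have "D * q \<le> (f y - f z) * p"
  proof (rule ccontr)
    assume "\<not> ?thesis"
    then have gap: "0 < D * q - (f y - f z) * p" by simp
    obtain m :: nat where m: "0 < m" "D * p < m * (D * q - (f y - f z) * p)"
      using reals_Archimedean3[OF gap] \<open>D \<ge> 0\<close> pq(1)
      by (metis less_le_not_le mult_nonneg_nonneg mult_zero_left neq0_conv of_nat_0)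
    then show False using approx[OF m(1)] by (simp add: algebra_simps)
  qed
  then show ?thesis by (simp add: D_def p_def q_def)
qed

lemma differences_nonneg_convex:
  assumes f: "differences_nonneg N I f" "2 \<le> N" and I: "is_interval I"
  shows "convex_on I f"
proof (rule convex_on_linorderI)
  show "convex I" using I by (simp add: is_interval_convex)
  fix t x y :: real
  assume t: "0 < t" "t < 1" and x: "x \<in> I" "y \<in> I" "x < y"
  define z where "z = (1 - t) * x + t * y"
  have zx: "z - x = t * (y - x)" "y - z = (1 - t) * (y - x)"
    by (simp_all add: z_def algebra_simps)
  then have "x < z" "z < y" using t x
    by (metis diff_gt_0_iff_gt mult_pos_pos)+
  then have "(f z - f x) * (y - z) \<le> (f y - f z) * (z - x)"
    using differences_nonneg_slope[OF f I] x by blast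
  then have "((f z - f x) * (1 - t)) * (y - x) \<le> ((f y - f z) * t) * (y - x)"
    by (simp add: zx mult_ac)
  then have "(f z - f x) * (1 - t) \<le> (f y - f z) * t"
    using x by (simp add: mult_le_cancel_right)
  then show "f ((1 - t) *\<^sub>R x + t *\<^sub>R y) \<le> (1 - t) * f x + t * f y"
    unfolding real_scaleR_def z_def[symmetric] by (simp add: algebra_simps)
qed

lemma differences_nonneg_isCont:
  assumes f: "differences_nonneg N I f" "2 \<le> N" and I: "open I" "is_interval I" "x \<in> I"
  shows "isCont f x"
  using convex_on_continuous[OF I(1) differences_nonneg_convex[OF f I(2)]] I
  by (simp add: continuous_on_eq_continuous_at)

lemma differences_nonneg_increment:
  assumes f: "differences_nonneg (Suc N) I f" and I: "is_interval I" and "0 < s"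
    and J: "is_interval J" "J \<subseteq> I" "\<And>y. y \<in> J \<Longrightarrow> y + s \<in> I"
  shows "differences_nonneg N J (\<lambda>y. f (y + s) - f y)"
  unfolding differences_nonneg_def
proof (intro allI impI)
  fix hs x assume hs: "length hs \<le> N" "\<forall>h\<in>set hs. 0 < h" and x: "x \<in> J" "x + sum_list hs \<in> J"
  have "0 \<le> fdiff (s # hs) f x"
    using hs x J(2,3) \<open>0 < s\<close> J(3)[OF x(2)]
    by (intro differences_nonnegD[OF f]) (auto simp: add_ac)
  then show "0 \<le> fdiff hs (\<lambda>y. f (y + s) - f y) x" by (simp add: fdiff_increment)
qed

text \<open>
  By convexity of \<open>f\<close>, the difference quotients \<open>q h\<close> at \<open>x\<close> are nondecreasing in \<open>h\<close>, so only
  \<open>q h - q (-h) \<rightarrow> 0\<close> as \<open>h \<rightarrow> 0+\<close> has to be shown. This is a second difference with two steps \<open>h\<close>,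
  divided by \<open>h\<close>. The third-order condition makes the increment \<open>y \<mapsto> f (y + h) - f y\<close> convex as well, and
  comparing its slope over \<open>[x - h, x]\<close> with that over \<open>[x - h, x - h + S]\<close> bounds the quotient by
  \<open>\<phi> h / S\<close>, where \<open>\<phi> h\<close> tends to zero since \<open>f\<close> is continuous.
\<close>

lemma differences_nonneg_differentiable:
  assumes f: "differences_nonneg N I f" "3 \<le> N" and I: "open I" "is_interval I" "x \<in> I"
  shows "\<exists>D. DERIV f x :> D"
proof -
  obtain e where e: "e > 0" "\<And>y. \<bar>y - x\<bar> < e \<Longrightarrow> y \<in> I"
    using I by (metis open_dist dist_real_def)
  have f2: "differences_nonneg 2 I f" and f3: "differences_nonneg 3 I f"
    using f by (auto intro: differences_nonneg_mono_order)
  define S where "S = e / 4"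
  have "S > 0" using e by (simp add: S_def)
  define \<phi> where "\<phi> s = (f (x + S) - f (x + S - s)) - (f x - f (x - s))" for s
  have gap: "(f (x + s) - f x) - (f x - f (x - s)) \<le> s / S * \<phi> s" if s: "0 < s" "s < S" for s
  proof -
    define J where "J = {x - 2 * S<..<x + 2 * S}"
    have J: "is_interval J" "J \<subseteq> I" "\<And>y. y \<in> J \<Longrightarrow> y + s \<in> I"
      using s by (auto simp: J_def is_interval_oo S_def intro!: e)
    have "differences_nonneg 2 J (\<lambda>y. f (y + s) - f y)"
      using f3 I(2) J s by (intro differences_nonneg_increment) (auto simp: numeral_3_eq_3)
    from differences_nonneg_slope[OF this _ J(1), of "x - s" "x - s + S" x]
    have "((f (x + s) - f x) - (f x - f (x - s))) * (S - s)
        \<le> ((f (x + S) - f (x + S - s)) - (f (x + s) - f x)) * s"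
      using s by (auto simp: J_def algebra_simps)
    then have "((f (x + s) - f x) - (f x - f (x - s))) * S \<le> s * \<phi> s"
      by (simp add: \<phi>_def algebra_simps)
    then show ?thesis using \<open>S > 0\<close> by (simp add: field_simps)
  qed
  have inI: "x \<in> I" "x + S \<in> I" using e by (auto intro!: e simp: S_def)
  have isCont: "isCont f y" if "y \<in> I" for y
    using differences_nonneg_isCont[OF f2 _ I(1,2) that] by simp
  have "isCont \<phi> 0"
    unfolding \<phi>_def
    by (intro continuous_diff continuous_const
        isCont_o2[where g = f and f = "\<lambda>s. x - s"] isCont_o2[where g = f and f = "\<lambda>s. x + S - s"])
       (simp_all add: isCont inI)
  moreover have "\<phi> 0 = 0" by (simp add: \<phi>_def)
  ultimately have \<phi>_tendsto: "(\<phi> \<longlongrightarrow> 0) (at 0)" by (metis isCont_def)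
  define q where "q h = (f (x + h) - f x) / h" for h
  have q_right: "q h \<le> q k" if "0 < h" "h \<le> k" "k < S" for h k
  proof (cases "h = k")
    case False
    have "(f (x + h) - f x) * (x + k - (x + h)) \<le> (f (x + k) - f (x + h)) * (x + h - x)"
      using that False by (intro differences_nonneg_slope[OF f2 _ I(2)] e) (auto simp: S_def intro!: e)
    then have "(f (x + h) - f x) * k \<le> (f (x + k) - f x) * h" by (simp add: algebra_simps)
    then show ?thesis using that by (simp add: q_def field_simps)
  qed simp
  have q_left: "q (-k) \<le> q (-h)" if "0 < h" "h \<le> k" "k < S" for h k
  proof (cases "h = k")
    case False
    have "(f (x - h) - f (x - k)) * (x - (x - h)) \<le> (f x - f (x - h)) * (x - h - (x - k))"
      using that False by (intro differences_nonneg_slope[OF f2 _ I(2)] e) (auto simp: S_def intro!: e)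
    then have "(f x - f (x - k)) * h \<le> (f x - f (x - h)) * k" by (simp add: algebra_simps)
    then show ?thesis using that by (simp add: q_def field_simps)
  qed simp
  have q_across: "q (-h) \<le> q h" if "0 < h" "h < S" for h
  proof -
    have "(f x - f (x - h)) * (x + h - x) \<le> (f (x + h) - f x) * (x - (x - h))"
      using that by (intro differences_nonneg_slope[OF f2 _ I(2)] e) (auto simp: S_def intro!: e)
    then show ?thesis using that by (simp add: q_def field_simps)
  qed
  have q_sep: "q (-h) \<le> q k" if "0 < h" "h < S" "0 < k" "k < S" for h k
    using q_left[of "min h k" h] q_across[of "min h k"] q_right[of "min h k" k] that by linarith
  define D where "D = (INF h\<in>{0<..<S}. q h)"
  have bdd: "bdd_below (q ` {0<..<S})"
    using q_sep[of "S/2"] \<open>S > 0\<close> by (intro bdd_belowI2[of _ "q (-(S/2))"]) auto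
  have D_right: "D \<le> q h" if "0 < h" "h < S" for h
    unfolding D_def using that by (intro cINF_lower[OF bdd]) auto
  have D_left: "q (-h) \<le> D" if "0 < h" "h < S" for h
    unfolding D_def using that q_sep by (intro cINF_greatest) auto
  have bound: "\<bar>q h - D\<bar> \<le> \<phi> \<bar>h\<bar> / S" if "h \<noteq> 0" "\<bar>h\<bar> < S" for h
  proof -
    have "\<bar>q h - D\<bar> \<le> q \<bar>h\<bar> - q (- \<bar>h\<bar>)"
      using D_right[of "\<bar>h\<bar>"] D_left[of "\<bar>h\<bar>"] that by (cases "h > 0") auto
    also have "\<dots> = ((f (x + \<bar>h\<bar>) - f x) - (f x - f (x - \<bar>h\<bar>))) / \<bar>h\<bar>"
      by (simp add: q_def diff_divide_distrib add_divide_distrib)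
    also have "\<dots> \<le> (\<bar>h\<bar> / S * \<phi> \<bar>h\<bar>) / \<bar>h\<bar>"
      using that by (intro divide_right_mono gap) auto
    also have "\<dots> = \<phi> \<bar>h\<bar> / S" using that by simp
    finally show ?thesis .
  qed
  have "((\<lambda>h. q h - D) \<longlongrightarrow> 0) (at 0)"
  proof (rule Lim_null_comparison)
    show "\<forall>\<^sub>F h in at 0. norm (q h - D) \<le> \<phi> \<bar>h\<bar> / S"
      using bound \<open>S > 0\<close> by (auto simp: eventually_at dist_real_def intro!: exI[of _ S])
    have "filterlim (\<lambda>h::real. \<bar>h\<bar>) (at 0) (at 0)"
      by (auto simp: filterlim_at eventually_at_filter intro!: tendsto_eq_intros)
    then have "((\<lambda>h. \<phi> \<bar>h\<bar>) \<longlongrightarrow> 0) (at 0)" by (rule filterlim_compose[OF \<phi>_tendsto])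
    then show "((\<lambda>h. \<phi> \<bar>h\<bar> / S) \<longlongrightarrow> 0) (at 0)" by (rule tendsto_divide_zero)
  qed
  then have "(q \<longlongrightarrow> D) (at 0)" by (simp add: Lim_null[symmetric])
  then show ?thesis unfolding DERIV_def q_def by blast
qed

text \<open>
  A difference of \<open>deriv f\<close> is the derivative of the same difference of \<open>f\<close>, which is nondecreasing
  because one more difference is still nonnegative.
\<close>

lemma differences_nonneg_deriv:
  assumes f: "differences_nonneg (Suc N) I f" "2 \<le> N" and I: "open I" "is_interval I"
  shows "differences_nonneg N I (deriv f)"
  unfolding differences_nonneg_def
proof (intro allI impI)
  fix hs x assume len: "length hs \<le> N" and "\<forall>h\<in>set hs. 0 < h"
    and x: "x \<in> I" "x + sum_list hs \<in> I"
  then have pos: "\<And>h. h \<in> set hs \<Longrightarrow> 0 < h" by blast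
  have "DERIV f y :> deriv f y" if "y \<in> I" for y
    using differences_nonneg_differentiable[OF f(1) _ I that] f(2) DERIV_imp_deriv by fastforce
  then have deriv: "DERIV (fdiff hs f) x :> fdiff hs (deriv f) x"
    using pos x by (intro DERIV_fdiff[OF I(2)])
  show "0 \<le> fdiff hs (deriv f) x"
  proof (rule ccontr)
    assume "\<not> ?thesis"
    then obtain d where d: "d > 0" "\<And>s. 0 < s \<Longrightarrow> s < d \<Longrightarrow> fdiff hs f (x + s) < fdiff hs f x"
      using DERIV_neg_dec_right[OF deriv] by auto
    obtain e where e: "e > 0" "\<And>y. \<bar>y - (x + sum_list hs)\<bar> < e \<Longrightarrow> y \<in> I"
      using I(1) x(2) by (metis open_dist dist_real_def)
    define s where "s = min d e / 2"
    have s: "0 < s" "s < d" "s < e" using d e by (auto simp: s_def)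
    have "0 \<le> fdiff (s # hs) f x"
      using len pos x s by (intro differences_nonnegD[OF f(1)]) (auto intro!: e)
    then show False using d(2)[of s] s by simp
  qed
qed

text \<open>
  After \<open>k\<close> differentiations nonnegative differences remain up to order \<open>N + 2 - k\<close>. This allows a
  further differentiation as long as \<open>k < N\<close>, and leaves order two, hence convexity, for \<open>k = N\<close>.
\<close>

lemma differences_nonneg_smooth:
  assumes "differences_nonneg (N + 2) I f" and I: "open I" "is_interval I"
  shows "C_k_on N f I"
    and "\<And>k x. k \<le> N \<Longrightarrow> x \<in> I \<Longrightarrow> 0 \<le> (deriv ^^ k) f x"
    and "convex_on I ((deriv ^^ N) f)"
    and "mono_on I ((deriv ^^ N) f)"
proof -
  have diffs: "differences_nonneg (N + 2 - k) I ((deriv ^^ k) f)" if "k \<le> N" for k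
    using that
  proof (induction k)
    case 0
    then show ?case using assms(1) by simp
  next
    case (Suc k)
    then have "differences_nonneg (Suc (N + 2 - Suc k)) I ((deriv ^^ k) f)"
      by (simp add: Suc_diff_le)
    then show ?case using differences_nonneg_deriv[OF _ _ I] Suc.prems by simp
  qed
  have top: "differences_nonneg 2 I ((deriv ^^ N) f)" using diffs[of N] by simp
  show nonneg: "0 \<le> (deriv ^^ k) f x" if "k \<le> N" "x \<in> I" for k x
    using differences_nonneg_imp_nonneg[OF diffs] that by blast
  show convex: "convex_on I ((deriv ^^ N) f)"
    by (rule differences_nonneg_convex[OF top _ I(2)]) simp
  show "mono_on I ((deriv ^^ N) f)"
    using differences_nonneg_imp_mono[OF top] by (intro mono_onI) simp
  show "C_k_on N f I"
    unfolding C_k_on_def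
  proof (intro conjI allI ballI impI)
    fix j x assume j: "j < N" "x \<in> I"
    then show "(deriv ^^ j) f field_differentiable at x"
      using differences_nonneg_differentiable[OF diffs[of j] _ I j(2)]
      by (auto simp: field_differentiable_def)
  qed (rule convex_on_continuous[OF I(1) convex])
qed

theorem theorem4p1:
  fixes R :: ereal and I :: "real set" and f :: "real \<Rightarrow> real" and n :: nat
  assumes R_pos: "0 < R"
    and I_eq: "I = {x. 0 < x \<and> ereal x < R}"
    and n_eq: "n = CARD('n::finite)"
    and n_ge: "n \<ge> 2"
    and psd: "\<And>(A :: real ^ 'n ^ 'n) a (u :: real ^ 'n).
        A \<in> psd_mats_rank_le 2 I \<Longrightarrow>
        0 \<le> a \<Longrightarrow> ereal a < R \<Longrightarrow>
        (\<And>i. 0 \<le> u $ i \<and> ereal (u $ i) < ereal_sqrt (R - ereal a)) \<Longrightarrow>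
        A = a *\<^sub>R all_ones + outer_prod u u \<Longrightarrow>
        entrywise f A \<in> psd_mats"
  shows "(n \<ge> 3 \<longrightarrow>
            C_k_on (n - 3) f I \<and>
            (\<forall>k\<le>n - 3. \<forall>x\<in>I. 0 \<le> (deriv ^^ k) f x) \<and>
            convex_on I ((deriv ^^ (n - 3)) f) \<and>
            mono_on I ((deriv ^^ (n - 3)) f)) \<and>
         (C_k_on (n - 1) f I \<longrightarrow>
            (\<forall>k\<le>n - 1. \<forall>x\<in>I. 0 \<le> (deriv ^^ k) f x))"
proof (intro conjI impI)
  have psd_f: "preserves_psd n I f"
    unfolding n_eq using preserves_psd_of_matrices[OF I_eq psd] .
  have I: "open I" "is_interval I"
  proof -
    have "I = {0<..} \<inter> {x. ereal x < R}" by (auto simp: I_eq)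
    moreover have "open {x. ereal x < R}"
      by (intro open_Collect_less continuous_intros)
    ultimately show "open I" by auto
    show "is_interval I"
      unfolding is_interval_1 I_eq
      by (auto intro: le_less_trans[of "ereal _" "ereal _"])
  qed
  {
    assume "3 \<le> n"
    then have "n - 3 + 2 = n - 1" by simp
    then have "differences_nonneg (n - 3 + 2) I f"
      using preserves_psd_differences_nonneg[OF psd_f n_ge I] by simp
    note smooth = differences_nonneg_smooth[OF this I]
    show "C_k_on (n - 3) f I" "convex_on I ((deriv ^^ (n - 3)) f)"
      "mono_on I ((deriv ^^ (n - 3)) f)" "\<forall>k\<le>n - 3. \<forall>x\<in>I. 0 \<le> (deriv ^^ k) f x"
      using smooth by blast+
  }
  show "\<forall>k\<le>n - 1. \<forall>x\<in>I. 0 \<le> (deriv ^^ k) f x" if smooth: "C_k_on (n - 1) f I"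
  proof (intro allI impI ballI)
    fix k x assume k: "k \<le> n - 1" and x: "x \<in> I"
    have deriv: "DERIV ((deriv ^^ j) f) y :> (deriv ^^ Suc j) f y" if "j < n - 1" "y \<in> I" for j y
      using smooth that by (simp add: C_k_on_def DERIV_deriv_iff_field_differentiable)
    show "0 \<le> (deriv ^^ k) f x"
    proof (rule preserves_psd_derivative_nonneg[where g = "\<lambda>j. (deriv ^^ j) f" and J = I])
      show "preserves_psd n I ((deriv ^^ 0) f)" using psd_f by simp
      show "k < n" using k n_ge by simp
      show "isCont ((deriv ^^ k) f) x"
      proof (cases "k = n - 1")
        case True
        then show ?thesis
          using smooth I(1) x by (simp add: C_k_on_def continuous_on_eq_continuous_at)
      next
        case False
        then show ?thesis using deriv[of k x] k x by (auto intro: DERIV_isCont)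
      qed
    qed (use I x k deriv in auto)
  qed
qed

end
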